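(* Let $X$ be a locally compact regular topological space, $S = (S, \le)$ a directed set, and $(X_s)_{s \in S}$ a net of nonempty subsets of $X$. Then the following properties are equivalent: (a) $(X_s)_{s \in S}$ converges from above to some nonempty compact set $K \subset X$. (b) $(X_s)_{s \in S}$ is eventually Lagrange stable. (c) $(X_s)_{s \in S}$ is asymptotically compact and limit set compact.
   Context: A directed set is a nonempty set with a preorder (reflexive, transitive relation) $\le$ in which every pair of elements has an upper bound. For directed sets $A, B$ and a map $h \colon B \to A$, write $h(\beta) \to \mathrm{bd}(A)$ as $\beta \to \mathrm{bd}(B)$ if for every $\alpha \in A$ there is $\beta_0 \in B$ such that $h(\beta) \ge \alpha$ for all $\beta \ge \beta_0$. A subnet of a net $(x_\alpha)_{\alpha \in A}$ is a net $(x_{h(\beta)})_{\beta \in B}$, with $B$ a directed set and $h \colon B \to A$ a map (not necessarily monotone) satisfying $h(\beta) \to \mathrm{bd}(A)$ as $\beta \to \mathrm{bd}(B)$; the same definition is used for nets of subsets, where a subnet $(X_{s_i})_{i \in I}$ of $(X_s)_{s \in S}$ comes with the index map $i \mapsto s_i$. Compactness means every open cover has a finite subcover (no Hausdorff assumption). $X$ is locally compact if every point has a compact neighborhood. $X$ is regular if for every $x \in X$ and every neighborhood $U$ of $x$ there is a closed neighborhood of $x$ contained in $U$ (no Hausdorff or $T_1$ assumption). The limit set of $(X_s)_{s \in S}$ is $L(X_s)_{s \in S} = \bigcap_{s \in S} \mathrm{cl} \bigcup_{t \in S, t \ge s} X_t$. $(X_s)_{s \in S}$ converges from above to $A \subset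 X$ if for every neighborhood $U$ of $A$ there is $s \in S$ with $\bigcup_{t \in S, t \ge s} X_t \subset U$. $(X_s)_{s \in S}$ is asymptotically compact if for every directed set $I$, every subnet $(X_{s_i})_{i \in I}$ of $(X_s)_{s \in S}$ and every $(y_i)_{i \in I} \in \prod_{i \in I} X_{s_i}$, the net $(y_i)_{i \in I}$ has a convergent subnet in $X$. $(X_s)_{s \in S}$ is limit set compact if $L(X_s)_{s \in S}$ is a nonempty compact set and $(X_s)_{s \in S}$ converges from above to $L(X_s)_{s \in S}$. $(X_s)_{s \in S}$ is eventually Lagrange stable if there is $s_0 \in S$ such that $\bigcup_{t \in S, t \ge s_0} X_t$ is relatively compact, i.e. its closure in $X$ is compact. *)

theory Defs
  imports "HOL-Analysis.Abstract_Topological_Spaces"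
begin

definition directed_set :: "'s set \<Rightarrow> ('s \<Rightarrow> 's \<Rightarrow> bool) \<Rightarrow> bool" where
  "directed_set A le \<longleftrightarrow>
     A \<noteq> {} \<and> reflp_on A le \<and> transp_on A le \<and>
     (\<forall>x\<in>A. \<forall>y\<in>A. \<exists>z\<in>A. le x z \<and> le y z)"

definition net_tail :: "'s set \<Rightarrow> ('s \<Rightarrow> 's \<Rightarrow> bool) \<Rightarrow> 's \<Rightarrow> 's set" where
  "net_tail A le a = {b \<in> A. le a b}"

text \<open>A net over a directed set converges iff it converges along the filter of tails of that
  directed set.\<close>

definition net_filter :: "'s set \<Rightarrow> ('s \<Rightarrow> 's \<Rightarrow> bool) \<Rightarrow> 's filter" where
  "net_filter A le = (INF a\<in>A. principal (net_tail A le a))"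

lemma eventually_net_filter:
  assumes "directed_set A le"
  shows "eventually P (net_filter A le) \<longleftrightarrow> (\<exists>a\<in>A. \<forall>b\<in>A. le a b \<longrightarrow> P b)"
proof -
  have "eventually P (net_filter A le) \<longleftrightarrow>
      (\<exists>a\<in>A. eventually P (principal (net_tail A le a)))"
    unfolding net_filter_def
  proof (rule eventually_INF_base)
    show "A \<noteq> {}"
      using assms by (simp add: directed_set_def)
    fix a b assume ab: "a \<in> A" "b \<in> A"
    then obtain c where c: "c \<in> A" "le a c" "le b c"
      using assms unfolding directed_set_def by blast
    have tr: "transp_on A le"
      using assms by (simp add: directed_set_def)
    have "net_tail A le c \<subseteq> net_tail A le a \<inter> net_tail A le b"
      using ab c transp_onD[OF tr] unfolding net_tail_def by blast
    with c show "\<exists>x\<in>A. principal (net_tail A le x) \<le>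
        inf (principal (net_tail A le a)) (principal (net_tail A le b))"
      by auto
  qed
  then show ?thesis
    by (auto simp: eventually_principal net_tail_def)
qed

text \<open>\<open>subnet_map B leB A leA h\<close>: precomposition with \<open>h\<close> turns nets over \<open>A\<close> into subnets over
  \<open>B\<close>. The map \<open>h\<close> is not required to be monotone.\<close>

definition subnet_map ::
  "'b set \<Rightarrow> ('b \<Rightarrow> 'b \<Rightarrow> bool) \<Rightarrow> 's set \<Rightarrow> ('s \<Rightarrow> 's \<Rightarrow> bool) \<Rightarrow> ('b \<Rightarrow> 's) \<Rightarrow> bool" where
  "subnet_map B leB A leA h \<longleftrightarrow>
     directed_set B leB \<and> h \<in> B \<rightarrow> A \<and>
     (\<forall>a\<in>A. \<exists>b0\<in>B. \<forall>b\<in>B. leB b0 b \<longrightarrow> leA a (h b))"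

text \<open>HOL cannot quantify over index sets of all types inside a formula, so the index type of the
  subnet is fixed. This is no restriction: by \<open>has_convergent_subnetI\<close> below, a convergent subnet
  over a directed set of any type yields one of this form.\<close>

definition has_convergent_subnet ::
  "'a topology \<Rightarrow> 'i set \<Rightarrow> ('i \<Rightarrow> 'i \<Rightarrow> bool) \<Rightarrow> ('i \<Rightarrow> 'a) \<Rightarrow> bool" where
  "has_convergent_subnet X A le y \<longleftrightarrow>
     (\<exists>(B :: ('i \<times> 'a set) set) leB h l.
        subnet_map B leB A le h \<and> limitin X (y \<circ> h) l (net_filter B leB))"

definition converges_from_above ::
  "'a topology \<Rightarrow> 's set \<Rightarrow> ('s \<Rightarrow> 's \<Rightarrow> bool) \<Rightarrow> ('s \<Rightarrow> 'a set) \<Rightarrow> 'a set \<Rightarrow> bool" where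
  "converges_from_above X S le Xs A \<longleftrightarrow>
     (\<forall>U. U \<subseteq> topspace X \<and> A \<subseteq> X interior_of U \<longrightarrow>
        (\<exists>s\<in>S. (\<Union>t\<in>net_tail S le s. Xs t) \<subseteq> U))"

definition limit_set ::
  "'a topology \<Rightarrow> 's set \<Rightarrow> ('s \<Rightarrow> 's \<Rightarrow> bool) \<Rightarrow> ('s \<Rightarrow> 'a set) \<Rightarrow> 'a set" where
  "limit_set X S le Xs = (\<Inter>s\<in>S. X closure_of (\<Union>t\<in>net_tail S le s. Xs t))"

definition limit_set_compact ::
  "'a topology \<Rightarrow> 's set \<Rightarrow> ('s \<Rightarrow> 's \<Rightarrow> bool) \<Rightarrow> ('s \<Rightarrow> 'a set) \<Rightarrow> bool" where
  "limit_set_compact X S le Xs \<longleftrightarrow>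
     limit_set X S le Xs \<noteq> {} \<and> compactin X (limit_set X S le Xs) \<and>
     converges_from_above X S le Xs (limit_set X S le Xs)"

definition eventually_Lagrange_stable ::
  "'a topology \<Rightarrow> 's set \<Rightarrow> ('s \<Rightarrow> 's \<Rightarrow> bool) \<Rightarrow> ('s \<Rightarrow> 'a set) \<Rightarrow> bool" where
  "eventually_Lagrange_stable X S le Xs \<longleftrightarrow>
     (\<exists>s0\<in>S. compactin X (X closure_of (\<Union>t\<in>net_tail S le s0. Xs t)))"

text \<open>Here, too, the type of the index sets \<open>I\<close> is fixed, and it is large enough: by
  \<open>asymptotically_compactD\<close> below, the defining property then holds for directed sets \<open>I\<close> of
  any type.\<close>

definition asymptotically_compact ::
  "'a topology \<Rightarrow> 's set \<Rightarrow> ('s \<Rightarrow> 's \<Rightarrow> bool) \<Rightarrow> ('s \<Rightarrow> 'a set) \<Rightarrow> bool" where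
  "asymptotically_compact X S le Xs \<longleftrightarrow>
     (\<forall>(I :: (('s \<times> 'a) \<times> ('s \<times> 'a) set) set) leI h y.
        subnet_map I leI S le h \<and> (\<forall>i\<in>I. y i \<in> Xs (h i)) \<longrightarrow>
        has_convergent_subnet X I leI y)"

lemma convergent_subnet_frequently:
  assumes A: "directed_set A le" and sub: "subnet_map B leB A le h"
    and lim: "limitin X (y \<circ> h) l (net_filter B leB)"
    and U: "openin X U" "l \<in> U" and a: "a \<in> A"
  shows "\<exists>b\<in>A. le a b \<and> y b \<in> U"
proof -
  have B: "directed_set B leB"
    using sub by (simp add: subnet_map_def)
  have "eventually (\<lambda>b. y (h b) \<in> U) (net_filter B leB)"
    using lim U by (simp add: limitin_def)
  then obtain b1 where b1: "b1 \<in> B" "\<And>b. b \<in> B \<Longrightarrow> leB b1 b \<Longrightarrow> y (h b) \<in> U"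
    unfolding eventually_net_filter[OF B] by blast
  obtain b0 where b0: "b0 \<in> B" "\<And>b. b \<in> B \<Longrightarrow> leB b0 b \<Longrightarrow> le a (h b)"
    using sub a unfolding subnet_map_def by blast
  obtain b where b: "b \<in> B" "leB b0 b" "leB b1 b"
    using B b0(1) b1(1) unfolding directed_set_def by blast
  have "h b \<in> A"
    using sub b by (auto simp: subnet_map_def)
  with b b0 b1 show ?thesis by blast
qed

lemma has_convergent_subnet_frequentlyI:
  fixes y :: "'i \<Rightarrow> 'a"
  assumes A: "directed_set A le" and l: "l \<in> topspace X"
    and freq: "\<And>U a. openin X U \<Longrightarrow> l \<in> U \<Longrightarrow> a \<in> A \<Longrightarrow> \<exists>b\<in>A. le a b \<and> y b \<in> U"
  shows "has_convergent_subnet X A le y"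
proof -
  define B where "B = {(a, U). a \<in> A \<and> openin X U \<and> l \<in> U \<and> y a \<in> U}"
  define leB where "leB = (\<lambda>(a, U) (b, V :: 'a set). le a b \<and> V \<subseteq> U)"
  have refl: "\<And>a. a \<in> A \<Longrightarrow> le a a"
    using A by (auto simp: directed_set_def reflp_on_def)
  have trans: "\<And>a b c. a \<in> A \<Longrightarrow> b \<in> A \<Longrightarrow> c \<in> A \<Longrightarrow> le a b \<Longrightarrow> le b c \<Longrightarrow> le a c"
    using A unfolding directed_set_def transp_on_def by blast
  have dirA: "\<And>a b. a \<in> A \<Longrightarrow> b \<in> A \<Longrightarrow> \<exists>c\<in>A. le a c \<and> le b c"
    using A unfolding directed_set_def by blast
  have ex: "\<exists>b. (b, U) \<in> B \<and> le a b" if "openin X U" "l \<in> U" "a \<in> A" for U a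
    using freq[OF that] that unfolding B_def by blast
  have B: "directed_set B leB"
    unfolding directed_set_def
  proof (intro conjI ballI)
    obtain a where "a \<in> A" using A by (auto simp: directed_set_def)
    with ex[OF openin_topspace l] show "B \<noteq> {}" by blast
    show "reflp_on B leB"
      using refl by (auto simp: reflp_on_def B_def leB_def)
    show "transp_on B leB"
      unfolding transp_on_def B_def leB_def using trans by fast
    fix p q assume "p \<in> B" "q \<in> B"
    then obtain a U b V where pq: "p = (a, U)" "q = (b, V)" "a \<in> A" "b \<in> A"
        "openin X U" "openin X V" "l \<in> U" "l \<in> V"
      unfolding B_def by blast
    obtain c where c: "c \<in> A" "le a c" "le b c" using dirA pq by blast
    have "openin X (U \<inter> V)" "l \<in> U \<inter> V" using pq by auto
    from ex[OF this c(1)] obtain d where d: "(d, U \<inter> V) \<in> B" "le c d" by blast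
    have "d \<in> A" using d by (simp add: B_def)
    then have "le a d" "le b d" using trans c d pq by blast+
    then have "leB p (d, U \<inter> V)" "leB q (d, U \<inter> V)"
      using pq by (auto simp: leB_def)
    with d show "\<exists>z\<in>B. leB p z \<and> leB q z" by blast
  qed
  have "subnet_map B leB A le fst"
    unfolding subnet_map_def
  proof (intro conjI ballI B)
    show "fst \<in> B \<rightarrow> A" by (auto simp: B_def)
    fix a assume a: "a \<in> A"
    obtain b where b: "(b, topspace X) \<in> B" "le a b" using ex[OF openin_topspace l a] by blast
    have "le a (fst p)" if "p \<in> B" "leB (b, topspace X) p" for p
      using that b trans[OF a, of b "fst p"] by (auto simp: B_def leB_def)
    with b show "\<exists>b0\<in>B. \<forall>p\<in>B. leB b0 p \<longrightarrow> le a (fst p)" by blast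
  qed
  moreover have "limitin X (y \<circ> fst) l (net_filter B leB)"
    unfolding limitin_def
  proof (intro conjI allI impI l)
    fix U assume U: "openin X U \<and> l \<in> U"
    obtain a where "a \<in> A" using A by (auto simp: directed_set_def)
    with U obtain b where b: "(b, U) \<in> B" using ex by blast
    have "(y \<circ> fst) p \<in> U" if "p \<in> B" "leB (b, U) p" for p
      using that by (auto simp: B_def leB_def)
    with b show "eventually (\<lambda>p. (y \<circ> fst) p \<in> U) (net_filter B leB)"
      unfolding eventually_net_filter[OF B] by blast
  qed
  ultimately show ?thesis
    unfolding has_convergent_subnet_def by blast
qed

lemma has_convergent_subnetI:
  assumes "directed_set A le" "subnet_map B leB A le h"
    and "limitin X (y \<circ> h) l (net_filter B leB)"
  shows "has_convergent_subnet X A le y"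
  by (rule has_convergent_subnet_frequentlyI[OF assms(1) limitin_topspace[OF assms(3)]])
     (rule convergent_subnet_frequently[OF assms])

lemma asymptotically_compactD:
  fixes I :: "'i set" and S :: "'s set" and X :: "'a topology"
  assumes ac: "asymptotically_compact X S le Xs"
    and sub: "subnet_map I leI S le h" and y: "\<forall>i\<in>I. y i \<in> Xs (h i)"
  shows "has_convergent_subnet X I leI y"
proof -
  define T where "T = (\<lambda>i0. (\<lambda>i. (h i, y i)) ` net_tail I leI i0)"
  define J where "J = {(p, W). p \<in> W \<and> (\<exists>i\<in>I. W = T i)}"
  define leJ where "leJ = (\<lambda>(p :: 's \<times> 'a, V) (q :: 's \<times> 'a, W :: ('s \<times> 'a) set). W \<subseteq> V)"
  have I: "directed_set I leI" using sub by (simp add: subnet_map_def)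
  have inT: "(h i, y i) \<in> T i" if "i \<in> I" for i
    using that I by (auto simp: T_def net_tail_def directed_set_def reflp_on_def)
  have inJ: "((h i, y i), T i) \<in> J" if "i \<in> I" for i
    using inT[OF that] that by (auto simp: J_def)
  have mono: "T j \<subseteq> T i" if "i \<in> I" "j \<in> I" "leI i j" for i j
    using that I unfolding T_def net_tail_def directed_set_def transp_on_def by blast
  have J: "directed_set J leJ"
    unfolding directed_set_def
  proof (intro conjI ballI)
    show "J \<noteq> {}" using I inJ by (auto simp: directed_set_def)
    show "reflp_on J leJ" by (auto simp: reflp_on_def leJ_def)
    show "transp_on J leJ" by (auto simp: transp_on_def leJ_def)
    fix p q assume "p \<in> J" "q \<in> J"
    then obtain p' q' i j where pq: "p = (p', T i)" "q = (q', T j)" "i \<in> I" "j \<in> I"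
      unfolding J_def by blast
    then obtain k where "k \<in> I" "leI i k" "leI j k"
      using I unfolding directed_set_def by blast
    with pq mono have "leJ p ((h k, y k), T k)" "leJ q ((h k, y k), T k)"
      by (simp_all add: leJ_def)
    with inJ[OF \<open>k \<in> I\<close>] show "\<exists>z\<in>J. leJ p z \<and> leJ q z" by blast
  qed
  have subJ: "subnet_map J leJ S le (fst \<circ> fst)"
    unfolding subnet_map_def
  proof (intro conjI ballI J)
    show "fst \<circ> fst \<in> J \<rightarrow> S"
      using sub by (auto simp: J_def T_def net_tail_def subnet_map_def)
    fix s assume "s \<in> S"
    then obtain i where i: "i \<in> I" "\<And>j. j \<in> I \<Longrightarrow> leI i j \<Longrightarrow> le s (h j)"
      using sub unfolding subnet_map_def by blast
    have "le s ((fst \<circ> fst) q)" if "q \<in> J" "leJ ((h i, y i), T i) q" for q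
    proof -
      have "fst q \<in> T i" using that by (auto simp: J_def leJ_def)
      then show ?thesis using i by (auto simp: T_def net_tail_def)
    qed
    with inJ[OF i(1)] show "\<exists>p\<in>J. \<forall>q\<in>J. leJ p q \<longrightarrow> le s ((fst \<circ> fst) q)" by blast
  qed
  have yJ: "\<forall>q\<in>J. (snd \<circ> fst) q \<in> Xs ((fst \<circ> fst) q)"
    using y by (auto simp: J_def T_def net_tail_def)
  have "has_convergent_subnet X J leJ (snd \<circ> fst)"
    using ac subJ yJ unfolding asymptotically_compact_def by blast
  then obtain B :: "((('s \<times> 'a) \<times> ('s \<times> 'a) set) \<times> 'a set) set" and leB g l
    where g: "subnet_map B leB J leJ g"
      and lim: "limitin X ((snd \<circ> fst) \<circ> g) l (net_filter B leB)"
    unfolding has_convergent_subnet_def by blast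
  show ?thesis
  proof (rule has_convergent_subnet_frequentlyI[OF I limitin_topspace[OF lim]])
    fix U i assume U: "openin X U" "l \<in> U" and i: "i \<in> I"
    from convergent_subnet_frequently[OF J g lim U inJ[OF i]]
    obtain q where q: "q \<in> J" "leJ ((h i, y i), T i) q" "(snd \<circ> fst) q \<in> U" by blast
    then have "fst q \<in> T i" by (auto simp: J_def leJ_def)
    with q show "\<exists>j\<in>I. leI i j \<and> y j \<in> U"
      by (auto simp: T_def net_tail_def)
  qed
qed

end

theory Submission imports Defs begin

text \<open>
  Everything rests on one compactness principle, \<open>closure_tail_subset_open\<close>: the closures of the
  tails of a net of sets form a family that is directed downwards and whose intersection is the
  limit set. If one of them is compact, then every open set containing the limit set already
  contains one of them.

  Eventual Lagrange stability provides such a compact closure. The limit set is closed and lies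
  in it, so it is compact; the rest of (c) consists of instances of the principle. Read directly,
  it says that the net converges from above to its limit set. For the empty open set it says that
  the limit set is nonempty, since the tails are. Applied to the
  net of singletons \<open>{y i}\<close>, whose limit set consists of the cluster points of \<open>y\<close>, it
  produces a cluster point, and hence a convergent subnet, of every net \<open>y\<close> that eventually stays
  in a compact closed set; this is asymptotic compactness.

  Conversely, (c) yields (a) with the limit set as \<open>K\<close>. From (a) to (b), local
  compactness and regularity give the compact set \<open>K\<close> a neighbourhood that is closed and compact.
  This neighbourhood contains a tail and, being closed, also the closure of that tail.
\<close>

lemma directed_set_finite_upper_bound:
  assumes A: "directed_set A le" and "finite F" "F \<subseteq> A"
  shows "\<exists>b\<in>A. \<forall>a\<in>F. le a b"
  using assms(2,3)
proof (induction F rule: finite_induct)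
  case empty
  then show ?case using A by (auto simp: directed_set_def)
next
  case (insert x F)
  then obtain b where b: "b \<in> A" "\<forall>a\<in>F. le a b" by blast
  obtain c where c: "c \<in> A" "le x c" "le b c"
    using A b insert.prems unfolding directed_set_def by blast
  have "le a c" if "a \<in> F" for a
    using A b c insert.prems that unfolding directed_set_def transp_on_def by blast
  with c show ?case by blast
qed

lemma in_net_tail_self:
  assumes "directed_set A le" "a \<in> A"
  shows "a \<in> net_tail A le a"
  using assms by (auto simp: net_tail_def directed_set_def reflp_on_def)

lemma net_tail_antimono:
  assumes "directed_set A le" "a \<in> A" "b \<in> A" "le a b"
  shows "net_tail A le b \<subseteq> net_tail A le a"
  using assms unfolding net_tail_def directed_set_def transp_on_def by blast

lemma net_tail_Union_nonempty:
  assumes "directed_set S le" "s \<in> S" "\<And>t. t \<in> S \<Longrightarrow> Xs t \<noteq> {}"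
  shows "(\<Union>t\<in>net_tail S le s. Xs t) \<noteq> {}"
  using in_net_tail_self[OF assms(1,2)] assms(2,3) by blast

text \<open>The part of the compact closure outside \<open>U\<close> is compact and is covered by the complements of
  the tail closures. Finitely many of them suffice, and the tail closure at a common upper bound
  of their indices lies in \<open>U\<close>.\<close>

lemma closure_tail_subset_open:
  assumes S: "directed_set S le" and s0: "s0 \<in> S"
    and comp: "compactin X (X closure_of (\<Union>t\<in>net_tail S le s0. Xs t))"
    and U: "openin X U" and sub: "limit_set X S le Xs \<subseteq> U"
  shows "\<exists>s\<in>S. X closure_of (\<Union>t\<in>net_tail S le s. Xs t) \<subseteq> U"
proof -
  define F where "F s = X closure_of (\<Union>t\<in>net_tail S le s. Xs t)" for s
  have F_closed: "closedin X (F s)" for s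
    by (simp add: F_def)
  have F_antimono: "F t \<subseteq> F s" if "s \<in> S" "t \<in> S" "le s t" for s t
    unfolding F_def using net_tail_antimono[OF S that] by (intro closure_of_mono) blast
  have "compactin X (F s0 - U)"
    using comp U by (metis F_closed F_def closed_compactin closedin_diff Diff_subset)
  moreover have "F s0 - U \<subseteq> \<Union>((\<lambda>s. topspace X - F s) ` S)"
  proof
    fix x assume x: "x \<in> F s0 - U"
    then have "x \<notin> (\<Inter>s\<in>S. F s)" using sub by (auto simp: limit_set_def F_def)
    moreover have "x \<in> topspace X" using x closedin_subset[OF F_closed] by blast
    ultimately show "x \<in> \<Union>((\<lambda>s. topspace X - F s) ` S)" by blast
  qed
  moreover have "\<forall>V \<in> (\<lambda>s. topspace X - F s) ` S. openin X V"
    using F_closed by auto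
  ultimately obtain G where "finite G" "G \<subseteq> (\<lambda>s. topspace X - F s) ` S" "F s0 - U \<subseteq> \<Union>G"
    using compactinD[of X "F s0 - U" "(\<lambda>s. topspace X - F s) ` S"] by auto
  then obtain T where T: "finite T" "T \<subseteq> S" "F s0 - U \<subseteq> (\<Union>t\<in>T. topspace X - F t)"
    by (metis finite_subset_image)
  obtain s where s: "s \<in> S" "\<forall>t\<in>insert s0 T. le t s"
    using directed_set_finite_upper_bound[OF S, of "insert s0 T"] T s0 by auto
  have "F s \<subseteq> F s0" "\<And>t. t \<in> T \<Longrightarrow> F s \<subseteq> F t"
    using F_antimono s s0 T(2) by auto
  with T(3) have "F s \<subseteq> U" by blast
  with s(1) show ?thesis unfolding F_def by blast
qed

lemma limit_set_nonempty:
  assumes "directed_set S le" "s0 \<in> S"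
    and "compactin X (X closure_of (\<Union>t\<in>net_tail S le s0. Xs t))"
    and Xs: "\<And>s. s \<in> S \<Longrightarrow> Xs s \<noteq> {} \<and> Xs s \<subseteq> topspace X"
  shows "limit_set X S le Xs \<noteq> {}"
proof
  assume "limit_set X S le Xs = {}"
  then obtain s where s: "s \<in> S" "X closure_of (\<Union>t\<in>net_tail S le s. Xs t) \<subseteq> {}"
    using closure_tail_subset_open[OF assms(1-3), of "{}"] by auto
  have "(\<Union>t\<in>net_tail S le s. Xs t) \<subseteq> X closure_of (\<Union>t\<in>net_tail S le s. Xs t)"
    using Xs by (intro closure_of_subset) (auto simp: net_tail_def)
  moreover have "(\<Union>t\<in>net_tail S le s. Xs t) \<noteq> {}"
    using Xs by (intro net_tail_Union_nonempty[OF assms(1) s(1)]) blast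
  ultimately show False using s(2) by blast
qed

text \<open>A point of the limit set of the singletons \<open>{y i}\<close> is a cluster point of \<open>y\<close>, and a cluster
  point is the limit of a subnet.\<close>

lemma eventually_in_compact_has_convergent_subnet:
  assumes I: "directed_set I le" and C: "compactin X C" "closedin X C"
    and y: "\<And>i. i \<in> I \<Longrightarrow> y i \<in> topspace X"
    and i0: "i0 \<in> I" "\<And>i. i \<in> I \<Longrightarrow> le i0 i \<Longrightarrow> y i \<in> C"
  shows "has_convergent_subnet X I le y"
proof -
  let ?tail = "\<lambda>i. \<Union>j\<in>net_tail I le i. {y j}"
  have "X closure_of ?tail i0 \<subseteq> C"
    using C i0 by (intro closure_of_minimal) (auto simp: net_tail_def)
  then have "compactin X (X closure_of ?tail i0)"
    by (rule closed_compactin[OF C(1)]) simp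
  then have "limit_set X I le (\<lambda>i. {y i}) \<noteq> {}"
    using y by (intro limit_set_nonempty[OF I i0(1)]) auto
  then obtain l where l: "\<And>i. i \<in> I \<Longrightarrow> l \<in> X closure_of ?tail i"
    unfolding limit_set_def by blast
  show ?thesis
  proof (rule has_convergent_subnet_frequentlyI[OF I])
    show "l \<in> topspace X" using l[OF i0(1)] by (simp add: in_closure_of)
    fix U i assume "openin X U" "l \<in> U" "i \<in> I"
    then show "\<exists>j\<in>I. le i j \<and> y j \<in> U"
      using l[of i] by (auto simp: in_closure_of net_tail_def)
  qed
qed

lemma eventually_Lagrange_stable_imp_asymptotically_compact:
  assumes stable: "eventually_Lagrange_stable X S le Xs"
    and Xs: "\<And>s. s \<in> S \<Longrightarrow> Xs s \<subseteq> topspace X"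
  shows "asymptotically_compact X S le Xs"
  unfolding asymptotically_compact_def
proof (intro allI impI, elim conjE)
  fix I :: "(('b \<times> 'a) \<times> ('b \<times> 'a) set) set" and leI h y
  assume sub: "subnet_map I leI S le h" and y: "\<forall>i\<in>I. y i \<in> Xs (h i)"
  obtain s0 where s0: "s0 \<in> S"
      "compactin X (X closure_of (\<Union>t\<in>net_tail S le s0. Xs t))" (is "compactin X ?C")
    using stable unfolding eventually_Lagrange_stable_def by blast
  have hS: "h i \<in> S" if "i \<in> I" for i
    using sub that by (auto simp: subnet_map_def)
  obtain i0 where i0: "i0 \<in> I" "\<And>i. i \<in> I \<Longrightarrow> leI i0 i \<Longrightarrow> le s0 (h i)"
    using sub s0(1) unfolding subnet_map_def by blast
  have tail: "(\<Union>t\<in>net_tail S le s0. Xs t) \<subseteq> ?C"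
    using Xs by (intro closure_of_subset) (auto simp: net_tail_def)
  show "has_convergent_subnet X I leI y"
  proof (rule eventually_in_compact_has_convergent_subnet[OF _ s0(2) _ _ i0(1)])
    show "directed_set I leI" using sub by (simp add: subnet_map_def)
    show "closedin X ?C" by simp
    show "y i \<in> topspace X" if "i \<in> I" for i
      using that y hS Xs by blast
    show "y i \<in> ?C" if "i \<in> I" "leI i0 i" for i
    proof -
      have "h i \<in> net_tail S le s0" using that hS i0(2) by (simp add: net_tail_def)
      then show ?thesis using that y tail by blast
    qed
  qed
qed

lemma eventually_Lagrange_stable_imp_limit_set_compact:
  assumes S: "directed_set S le" and stable: "eventually_Lagrange_stable X S le Xs"
    and Xs: "\<And>s. s \<in> S \<Longrightarrow> Xs s \<noteq> {} \<and> Xs s \<subseteq> topspace X"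
  shows "limit_set_compact X S le Xs"
proof -
  obtain s0 where s0: "s0 \<in> S" "compactin X (X closure_of (\<Union>t\<in>net_tail S le s0. Xs t))"
    using stable unfolding eventually_Lagrange_stable_def by blast
  have "limit_set X S le Xs \<noteq> {}"
    by (rule limit_set_nonempty[OF S s0 Xs])
  moreover have "compactin X (limit_set X S le Xs)"
    unfolding limit_set_def using s0(1) by (intro closed_compactin_Inter[OF s0(2)]) auto
  moreover have "converges_from_above X S le Xs (limit_set X S le Xs)"
    unfolding converges_from_above_def
  proof (intro allI impI)
    fix U assume U: "U \<subseteq> topspace X \<and> limit_set X S le Xs \<subseteq> X interior_of U"
    then obtain s where s: "s \<in> S"
        "X closure_of (\<Union>t\<in>net_tail S le s. Xs t) \<subseteq> X interior_of U"
      using closure_tail_subset_open[OF S s0, of "X interior_of U"] by auto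
    have "(\<Union>t\<in>net_tail S le s. Xs t) \<subseteq> X closure_of (\<Union>t\<in>net_tail S le s. Xs t)"
      using Xs by (intro closure_of_subset) (auto simp: net_tail_def)
    also note s(2)
    also have "X interior_of U \<subseteq> U" by (rule interior_of_subset)
    finally show "\<exists>s\<in>S. (\<Union>t\<in>net_tail S le s. Xs t) \<subseteq> U"
      using s(1) by (rule bexI)
  qed
  ultimately show ?thesis by (simp add: limit_set_compact_def)
qed

lemma converges_from_above_compact_imp_eventually_Lagrange_stable:
  assumes X: "locally_compact_space X" "regular_space X"
    and K: "compactin X K" "converges_from_above X S le Xs K"
  shows "eventually_Lagrange_stable X S le Xs"
proof -
  have "\<forall>K. compactin X K \<longrightarrow>
      (\<exists>U L. openin X U \<and> compactin X L \<and> closedin X L \<and> K \<subseteq> U \<and> U \<subseteq> L)"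
    using X locally_compact_space_compact_closed_compact[of X] by simp
  then obtain U L where UL: "openin X U" "compactin X L" "closedin X L" "K \<subseteq> U" "U \<subseteq> L"
    using K(1) by meson
  then have "K \<subseteq> X interior_of U" "U \<subseteq> topspace X"
    by (simp_all add: interior_of_openin openin_subset)
  then obtain s where s: "s \<in> S" "(\<Union>t\<in>net_tail S le s. Xs t) \<subseteq> U"
    using K(2) unfolding converges_from_above_def by blast
  have "X closure_of (\<Union>t\<in>net_tail S le s. Xs t) \<subseteq> L"
    using s UL by (intro closure_of_minimal) blast+
  then have "compactin X (X closure_of (\<Union>t\<in>net_tail S le s. Xs t))"
    by (rule closed_compactin[OF UL(2)]) simp
  with s(1) show ?thesis unfolding eventually_Lagrange_stable_def by blast
qed

theorem lemma3p15:
  fixes X :: "'a topology" and S :: "'s set" and le :: "'s \<Rightarrow> 's \<Rightarrow> bool"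
    and Xs :: "'s \<Rightarrow> 'a set"
  assumes "locally_compact_space X" and "regular_space X"
    and "directed_set S le"
    and "\<And>s. s \<in> S \<Longrightarrow> Xs s \<noteq> {} \<and> Xs s \<subseteq> topspace X"
  shows "((\<exists>K. K \<noteq> {} \<and> compactin X K \<and> converges_from_above X S le Xs K) \<longleftrightarrow>
            eventually_Lagrange_stable X S le Xs) \<and>
         (eventually_Lagrange_stable X S le Xs \<longleftrightarrow>
            asymptotically_compact X S le Xs \<and> limit_set_compact X S le Xs)"
proof -
  have ab: "eventually_Lagrange_stable X S le Xs"
    if "compactin X K" "converges_from_above X S le Xs K" for K
    by (rule converges_from_above_compact_imp_eventually_Lagrange_stable[OF assms(1,2) that])
  have bc: "asymptotically_compact X S le Xs \<and> limit_set_compact X S le Xs"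
    if "eventually_Lagrange_stable X S le Xs"
    using eventually_Lagrange_stable_imp_asymptotically_compact[OF that]
      eventually_Lagrange_stable_imp_limit_set_compact[OF assms(3) that] assms(4) by blast
  have ca: "\<exists>K. K \<noteq> {} \<and> compactin X K \<and> converges_from_above X S le Xs K"
    if "limit_set_compact X S le Xs"
    using that unfolding limit_set_compact_def by blast
  show ?thesis using ab bc ca by blast
qed

end
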